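(* Let $\alpha$ be a constant with $0<\alpha<1$. Then there is a positive constant $c$, depending only on $\alpha$, such that for all positive integers $n$ and $d$ with $d=n^{\alpha}$, $$P(n,d)\ \ge\ c\,\frac{n!}{V(n,d-1)}\,\log_2 V(n,d-1).$$
   Context: $S_n$ is the group of permutations of $Z_n=\{0,1,\ldots,n-1\}$. The Hamming distance $d(\mathbf{x},\mathbf{y})$ of $\mathbf{x},\mathbf{y}\in S_n$ is the number of $i\in Z_n$ with $\mathbf{x}(i)\neq\mathbf{y}(i)$. An $(n,d)$ permutation array (PA) is a subset $C\subseteq S_n$ in which any two distinct elements have distance at least $d$; $P(n,d)$ is the maximum size of an $(n,d)$ PA. $D_k$ is the number of derangements (permutations without fixed points) of $k$ elements, with $D_0=1$. $V(n,d-1)=\sum_{i=0}^{d-1}\binom{n}{i}D_i$. *)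

theory Defs
  imports Complex_Main "HOL-Combinatorics.Permutations"
begin

(* A permutation of Z_n = {..<n} is represented by its unique extension to a function on nat that
   fixes every i >= n, so that equality of functions is equality of permutations of Z_n. *)
definition sym_perms :: "nat \<Rightarrow> (nat \<Rightarrow> nat) set" where
  "sym_perms n = {p. p permutes {..<n}}"

definition hamming :: "nat \<Rightarrow> (nat \<Rightarrow> nat) \<Rightarrow> (nat \<Rightarrow> nat) \<Rightarrow> nat" where
  "hamming n x y = card {i \<in> {..<n}. x i \<noteq> y i}"

definition perm_array :: "nat \<Rightarrow> nat \<Rightarrow> (nat \<Rightarrow> nat) set \<Rightarrow> bool" where
  "perm_array n d C \<longleftrightarrow>
     C \<subseteq> sym_perms n \<and> (\<forall>x\<in>C. \<forall>y\<in>C. x \<noteq> y \<longrightarrow> d \<le> hamming n x y)"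

definition PA_max :: "nat \<Rightarrow> nat \<Rightarrow> nat" where
  "PA_max n d = Max (card ` {C. perm_array n d C})"

definition derangements :: "nat \<Rightarrow> nat" where
  "derangements k = card {p \<in> sym_perms k. \<forall>i<k. p i \<noteq> i}"

definition V_ball :: "nat \<Rightarrow> nat \<Rightarrow> nat" where
  "V_ball n r = (\<Sum>i=0..r. (n choose i) * derangements i)"

lemma finite_sym_perms: "finite (sym_perms n)"
  by (simp add: sym_perms_def finite_permutations)

lemma derangements_0: "derangements 0 = 1"
proof -
  have "{p \<in> sym_perms 0. \<forall>i<0. p i \<noteq> i} = {id}"
    by (auto simp: sym_perms_def)
  then show ?thesis
    by (simp add: derangements_def)
qed

(* The maximum defining PA_max is taken over a finite nonempty set, hence is a genuine maximum. *)
lemma finite_perm_arrays: "finite {C. perm_array n d C}"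
  by (rule finite_subset[of _ "Pow (sym_perms n)"])
     (auto simp: perm_array_def finite_sym_perms)

lemma perm_array_empty: "perm_array n d {}"
  by (simp add: perm_array_def)

lemma PA_max_attained: "\<exists>C. perm_array n d C \<and> card C = PA_max n d"
proof -
  have "PA_max n d \<in> card ` {C. perm_array n d C}"
    unfolding PA_max_def
    by (rule Max_in) (use finite_perm_arrays perm_array_empty in blast)+
  then show ?thesis
    by auto
qed

lemma card_le_PA_max: "perm_array n d C \<Longrightarrow> card C \<le> PA_max n d"
  unfolding PA_max_def by (rule Max_ge) (auto simp: finite_perm_arrays)

end

theory Submission
  imports Defs
begin

text \<open>
  Join two permutations of \<open>{..<n}\<close> when their distance is at most \<open>r = d - 1\<close>; arrays are the
  independent sets of this graph, whose degrees are below \<open>V = V(n, r)\<close>. Choose an independent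
  set \<open>I\<close> at random with probability proportional to \<open>l ^ |I|\<close> (the hard-core model). If a vertex
  \<open>v\<close> has \<open>h\<close> neighbours that are not blocked from outside its neighbourhood, then \<open>v\<close> itself is
  occupied with probability about \<open>l * exp (- l * h)\<close>, and the expected number of occupied
  neighbours is about \<open>l * h\<close>, up to an error of order \<open>l\<^sup>2 T\<close> where \<open>T\<close> bounds the number of
  adjacent pairs in a neighbourhood. Whatever \<open>h\<close> is, \<open>V\<close> times the former plus the latter is at
  least of order \<open>ln (V * l)\<close>; summing over \<open>v\<close> gives an independent set of size of order
  \<open>n! / V * ln (V * l)\<close>.

  Two permutations at mutual distance at most \<open>r\<close>, both at distance at most \<open>r\<close> from \<open>v\<close>, differ
  from \<open>v\<close> on at most \<open>3 r / 2\<close> points altogether. So \<open>T\<close> is smaller than \<open>V\<^sup>2\<close> by a factor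
  \<open>(n / (C r)) powr (r / 2)\<close>, which is at least a fixed positive power of \<open>n ^ r\<close> when \<open>r < n powr \<alpha>\<close>
  and \<open>n\<close> is large, and with
  \<open>l = 1 / sqrt T\<close> the logarithm \<open>ln (V * l)\<close> is of the order of \<open>ln V\<close>.
\<close>

section \<open>Independent sets in locally sparse graphs\<close>

definition indep_sets :: "('a \<Rightarrow> 'a \<Rightarrow> bool) \<Rightarrow> 'a set \<Rightarrow> 'a set set" where
  "indep_sets E S = {I. I \<subseteq> S \<and> (\<forall>x\<in>I. \<forall>y\<in>I. \<not> E x y)}"

text \<open>The partition function of the hard-core model at activity \<open>l\<close>, that is, the
  independence polynomial of the graph on \<open>S\<close>. Probabilities enter below as
  unnormalised sums compared with it.\<close>

definition hard_core :: "('a \<Rightarrow> 'a \<Rightarrow> bool) \<Rightarrow> real \<Rightarrow> 'a set \<Rightarrow> real" where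
  "hard_core E l S = (\<Sum>I\<in>indep_sets E S. l ^ card I)"

lemma finite_indep_sets: "finite S \<Longrightarrow> finite (indep_sets E S)"
  by (rule finite_subset[of _ "Pow S"]) (auto simp: indep_sets_def)

lemma indep_sets_mono: "S \<subseteq> T \<Longrightarrow> indep_sets E S \<subseteq> indep_sets E T"
  by (auto simp: indep_sets_def)

lemma empty_indep_sets [simp]: "{} \<in> indep_sets E S"
  by (auto simp: indep_sets_def)

lemma indep_sets_finite: "I \<in> indep_sets E S \<Longrightarrow> finite S \<Longrightarrow> finite I"
  by (auto simp: indep_sets_def intro: finite_subset)

lemma hard_core_ge_1:
  fixes l :: real
  assumes "finite S" "l \<ge> 0"
  shows "1 \<le> hard_core E l S"
proof -
  have "l ^ card {} \<le> hard_core E l S"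
    unfolding hard_core_def
    using member_le_sum[of "{}" "indep_sets E S" "\<lambda>I. l ^ card I"] assms
    by (simp add: finite_indep_sets)
  then show ?thesis by simp
qed

lemma hard_core_le_exp:
  fixes l :: real
  assumes "finite S" "l \<ge> 0"
  shows "hard_core E l S \<le> exp (l * card S)"
proof -
  have "hard_core E l S \<le> (\<Sum>I\<in>Pow S. l ^ card I)"
    unfolding hard_core_def using assms by (intro sum_mono2) (auto simp: indep_sets_def)
  also have "\<dots> = (\<Prod>x\<in>S. l + 1)"
    using prod_add[OF assms(1), of "\<lambda>_. l" "\<lambda>_. 1"] by simp
  also have "\<dots> \<le> exp l ^ card S"
    using assms exp_ge_add_one_self[of l] by (simp add: add.commute power_mono)
  also have "\<dots> = exp (l * card S)"
    by (metis exp_of_nat_mult mult.commute)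
  finally show ?thesis .
qed

text \<open>Deleting \<open>u\<close> is a bijection onto the independent sets of the graph without
  the closed neighbourhood of \<open>u\<close>, and it costs one factor \<open>l\<close>.\<close>

lemma sum_indep_sets_containing:
  fixes l :: real
  assumes "finite S" "u \<in> S" "symp E" "irreflp E"
  shows "(\<Sum>I\<in>{I\<in>indep_sets E S. u \<in> I}. l ^ card I)
           = l * hard_core E l {w\<in>S. w \<noteq> u \<and> \<not> E u w}"
proof -
  let ?R = "{w\<in>S. w \<noteq> u \<and> \<not> E u w}"
  have inj: "inj_on (insert u) (indep_sets E ?R)"
    by (rule inj_onI) (auto simp: indep_sets_def)
  have img: "insert u ` indep_sets E ?R = {I\<in>indep_sets E S. u \<in> I}"
  proof (intro equalityI subsetI)
    fix I assume "I \<in> insert u ` indep_sets E ?R"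
    then show "I \<in> {I\<in>indep_sets E S. u \<in> I}"
      using assms by (fastforce simp: indep_sets_def symp_def irreflp_def)
  next
    fix I assume I: "I \<in> {I\<in>indep_sets E S. u \<in> I}"
    then have "I = insert u (I - {u})" "I - {u} \<in> indep_sets E ?R"
      by (auto simp: indep_sets_def)
    then show "I \<in> insert u ` indep_sets E ?R" by blast
  qed
  have "card (insert u I) = Suc (card I)" if "I \<in> indep_sets E ?R" for I
  proof -
    have "finite I" by (rule indep_sets_finite[OF that]) (simp add: assms)
    moreover have "u \<notin> I" using that by (auto simp: indep_sets_def)
    ultimately show ?thesis by simp
  qed
  then show ?thesis
    unfolding img[symmetric] sum.reindex[OF inj] hard_core_def sum_distrib_left
    by (intro sum.cong) auto
qed

lemma hard_core_mono:
  fixes l :: real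
  assumes "S \<subseteq> T" "finite T" "l \<ge> 0"
  shows "hard_core E l S \<le> hard_core E l T"
  unfolding hard_core_def
  using assms indep_sets_mono[of S T E] by (intro sum_mono2) (auto simp: finite_indep_sets)

lemma sum_UN_le:
  fixes f :: "'a \<Rightarrow> real"
  assumes "finite A" "\<And>i. i \<in> A \<Longrightarrow> finite (B i)" "\<And>x. 0 \<le> f x"
  shows "sum f (\<Union>i\<in>A. B i) \<le> (\<Sum>i\<in>A. sum f (B i))"
  using assms(1,2)
proof (induction A rule: finite_induct)
  case (insert i A)
  have "sum f (B i \<union> (\<Union>i\<in>A. B i)) \<le> sum f (B i) + sum f (\<Union>i\<in>A. B i)"
    using insert assms(3) by (subst sum_Un) (auto intro: sum_nonneg)
  also have "\<dots> \<le> (\<Sum>i\<in>insert i A. sum f (B i))"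
    using insert by simp
  finally show ?case by simp
qed simp

text \<open>An independent set avoiding the closed neighbourhood of \<open>u\<close> is the typical one:
  each of the \<open>1 + deg u\<close> vertices of that neighbourhood is occupied with probability at most \<open>l\<close>.\<close>

lemma hard_core_delete_nbhd:
  fixes l :: real
  assumes "finite S" "u \<in> S" "symp E" "irreflp E" "l \<ge> 0"
  shows "hard_core E l {w\<in>S. w \<noteq> u \<and> \<not> E u w}
           \<ge> hard_core E l S * (1 - l * (1 + card {w\<in>S. E u w}))"
proof -
  let ?R = "{w\<in>S. w \<noteq> u \<and> \<not> E u w}" and ?N = "{w\<in>S. w = u \<or> E u w}"
  let ?C = "\<lambda>w. {I\<in>indep_sets E S. w \<in> I}"
  have fin: "finite (indep_sets E ?R)" "finite ?N" "\<And>w. finite (?C w)"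
    using assms by (auto simp: finite_indep_sets)
  have "indep_sets E S \<subseteq> indep_sets E ?R \<union> (\<Union>w\<in>?N. ?C w)"
    by (auto simp: indep_sets_def)
  then have "hard_core E l S \<le> (\<Sum>I\<in>indep_sets E ?R \<union> (\<Union>w\<in>?N. ?C w). l ^ card I)"
    unfolding hard_core_def using assms fin by (intro sum_mono2) auto
  also have "\<dots> \<le> hard_core E l ?R + (\<Sum>I\<in>(\<Union>w\<in>?N. ?C w). l ^ card I)"
    unfolding hard_core_def using fin assms
    by (subst sum_Un) (auto intro!: sum_nonneg)
  also have "(\<Sum>I\<in>(\<Union>w\<in>?N. ?C w). l ^ card I) \<le> (\<Sum>w\<in>?N. \<Sum>I\<in>?C w. l ^ card I)"
    using fin assms by (intro sum_UN_le) auto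
  also have "\<dots> \<le> (\<Sum>w\<in>?N. l * hard_core E l S)"
  proof (rule sum_mono)
    fix w assume "w \<in> ?N"
    then have "w \<in> S" using assms by auto
    then show "(\<Sum>I\<in>?C w. l ^ card I) \<le> l * hard_core E l S"
      using sum_indep_sets_containing[OF assms(1) \<open>w \<in> S\<close> assms(3,4), of l] assms(1,5)
        hard_core_mono[of "{v\<in>S. v \<noteq> w \<and> \<not> E w v}" S l E]
      by (simp add: mult_left_mono)
  qed
  also have "\<dots> = (1 + card {w\<in>S. E u w}) * (l * hard_core E l S)"
  proof -
    have "?N = insert u {w\<in>S. E u w}" using assms by auto
    moreover have "\<not> E u u" using assms by (simp add: irreflp_def)
    ultimately have "card ?N = 1 + card {w\<in>S. E u w}" using assms by simp
    then show ?thesis by simp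
  qed
  finally show ?thesis by (simp add: algebra_simps)
qed

text \<open>Incidences of \<open>u\<close> in \<open>I\<close> are counted vertex by vertex, each
  share being bounded through \<open>hard_core_delete_nbhd\<close>; the degrees then add up to the
  number of ordered adjacent pairs.\<close>

lemma sum_card_indep_sets_ge:
  fixes l :: real
  assumes "finite S" "symp E" "irreflp E" "l \<ge> 0"
  shows "(\<Sum>I\<in>indep_sets E S. l ^ card I * card I)
    \<ge> hard_core E l S * (l * card S - l\<^sup>2 * card S - l\<^sup>2 * card {(u, w). u \<in> S \<and> w \<in> S \<and> E u w})"
proof -
  let ?Z = "hard_core E l S" and ?d = "\<lambda>u. card {w\<in>S. E u w}"
  have cE: "card {(u, w). u \<in> S \<and> w \<in> S \<and> E u w} = (\<Sum>u\<in>S. ?d u)"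
  proof -
    have "{(u, w). u \<in> S \<and> w \<in> S \<and> E u w} = Sigma S (\<lambda>u. {w\<in>S. E u w})" by auto
    then show ?thesis using assms by simp
  qed
  have "(\<Sum>I\<in>indep_sets E S. l ^ card I * card I)
      = (\<Sum>I\<in>indep_sets E S. \<Sum>u\<in>{u\<in>S. u \<in> I}. l ^ card I)"
  proof (rule sum.cong)
    fix I assume "I \<in> indep_sets E S"
    then have "{u\<in>S. u \<in> I} = I" by (auto simp: indep_sets_def)
    then show "l ^ card I * card I = (\<Sum>u\<in>{u\<in>S. u \<in> I}. l ^ card I)" by simp
  qed simp
  also have "\<dots> = (\<Sum>u\<in>S. \<Sum>I\<in>{I\<in>indep_sets E S. u \<in> I}. l ^ card I)"
    by (rule sum.swap_restrict) (simp_all add: assms finite_indep_sets)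
  also have "\<dots> \<ge> (\<Sum>u\<in>S. l * (?Z * (1 - l * (1 + ?d u))))"
  proof (rule sum_mono)
    fix u assume u: "u \<in> S"
    show "l * (?Z * (1 - l * (1 + ?d u))) \<le> (\<Sum>I\<in>{I\<in>indep_sets E S. u \<in> I}. l ^ card I)"
      unfolding sum_indep_sets_containing[OF assms(1) u assms(2,3)]
      by (rule mult_left_mono[OF hard_core_delete_nbhd[OF assms(1) u assms(2-4)] assms(4)])
  qed
  also have "(\<Sum>u\<in>S. l * (?Z * (1 - l * (1 + ?d u))))
      = ?Z * (l * card S - l\<^sup>2 * card S - l\<^sup>2 * (\<Sum>u\<in>S. ?d u))"
    by (simp add: algebra_simps sum.distrib sum_subtractf sum_distrib_left power2_eq_square)
  finally show ?thesis unfolding cE .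
qed

text \<open>In the application \<open>H\<close> consists of the unblocked neighbours of a vertex,
  with weight \<open>hard_core E l H\<close> against weight \<open>l\<close> for occupying the
  vertex itself. If \<open>H\<close> is large, many neighbours are occupied; if it is small, its
  partition function is dwarfed by \<open>D * l\<close>.\<close>

lemma local_occupancy:
  fixes D l :: real
  assumes "finite H" "symp E" "irreflp E" "0 < l" "l \<le> 1/2" "D > 0"
    and T: "l\<^sup>2 * card {(u, w). u \<in> H \<and> w \<in> H \<and> E u w} \<le> 1"
    and L: "4 \<le> ln (D * l)"
  shows "D * l + (\<Sum>I\<in>indep_sets E H. l ^ card I * card I)
          \<ge> (ln (D * l) / 4 - 1) / 2 * (l + hard_core E l H)"
proof -
  let ?Z = "hard_core E l H" and ?L = "ln (D * l)"
  define x where "x = l * card H"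
  have Z1: "1 \<le> ?Z" and Zx: "?Z \<le> exp x"
    using hard_core_ge_1[of H l E] hard_core_le_exp[of H l E] assms by (simp_all add: x_def)
  have x0: "x \<ge> 0" using assms by (simp add: x_def)
  have "l\<^sup>2 * card H \<le> x / 2"
    using mult_right_mono[of l "1/2" "l * card H"] assms
    by (simp add: x_def power2_eq_square mult.assoc)
  then have "?Z * (x / 2 - 1) \<le> ?Z * (l * card H - l\<^sup>2 * card H
                - l\<^sup>2 * card {(u, w). u \<in> H \<and> w \<in> H \<and> E u w})"
    using Z1 T by (intro mult_left_mono) (auto simp: x_def)
  also have "\<dots> \<le> (\<Sum>I\<in>indep_sets E H. l ^ card I * card I)"
    using sum_card_indep_sets_ge[of H E l] assms by simp
  finally have A: "?Z * (x / 2 - 1) \<le> (\<Sum>I\<in>indep_sets E H. l ^ card I * card I)" .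
  have Dl: "D * l = exp ?L" using assms by simp
  have "?Z * (?L / 4 - 1) \<le> D * l + ?Z * (x / 2 - 1)"
  \<comment> \<open>The regimes meet at half the logarithm: above it the term linear in
    \<open>x\<close> suffices, below it \<open>?Z\<close> is less than \<open>exp (?L / 2)\<close>,
    the square root of \<open>D * l\<close>.\<close>
  proof (cases "x \<ge> ?L / 2")
    case True
    then have "?Z * (?L / 4 - 1) \<le> ?Z * (x / 2 - 1)"
      using Z1 by (intro mult_left_mono) auto
    then show ?thesis using assms by (smt (verit) mult_pos_pos)
  next
    case False
    have "?L / 4 \<le> exp (?L / 2)"
      using exp_ge_add_one_self[of "?L/2"] L by linarith
    then have "?Z * (?L / 4) \<le> exp x * exp (?L / 2)"
      using L Z1 Zx by (intro mult_mono) auto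
    also have "\<dots> \<le> exp ?L" using False by (simp add: exp_add[symmetric])
    finally have "?Z * (?L / 4) \<le> D * l" using Dl by simp
    moreover have "0 \<le> ?Z * (x / 2)" using x0 Z1 by simp
    ultimately show ?thesis by (simp add: algebra_simps)
  qed
  \<comment> \<open>Since \<open>l \<le> 1 \<le> ?Z\<close>, the total weight is at most
    \<open>2 * ?Z\<close>; hence the halved constant.\<close>
  moreover have "(?L / 4 - 1) / 2 * (l + ?Z) \<le> (?L / 4 - 1) / 2 * (2 * ?Z)"
    using L Z1 assms by (intro mult_left_mono) auto
  moreover have "(?L / 4 - 1) / 2 * (2 * ?Z) = ?Z * (?L / 4 - 1)" by simp
  ultimately show ?thesis using A by linarith
qed

text \<open>The independent sets are grouped by their part \<open>J\<close> outside the closed neighbourhood of \<open>v\<close>: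
  such a \<open>J\<close> extends by \<open>v\<close> alone, or by an independent set of those neighbours of \<open>v\<close> that
  are not adjacent to \<open>J\<close>.\<close>

lemma vertex_occupancy:
  fixes D l :: real
  assumes "finite A" "v \<in> A" "symp E" "irreflp E" "0 < l" "l \<le> 1/2" "D > 0"
    and T: "l\<^sup>2 * card {(u, w). u \<in> A \<and> w \<in> A \<and> E v u \<and> E v w \<and> E u w} \<le> 1"
    and L: "4 \<le> ln (D * l)"
  shows "(\<Sum>I\<in>indep_sets E A. l ^ card I * (D * of_bool (v \<in> I) + card {u\<in>I. E v u}))
          \<ge> (ln (D * l) / 4 - 1) / 2 * hard_core E l A"
proof -
  let ?c = "(ln (D * l) / 4 - 1) / 2"
  let ?B = "{w\<in>A. w \<noteq> v \<and> \<not> E v w}"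
  let ?f = "\<lambda>I. l ^ card I * (D * of_bool (v \<in> I) + card {u\<in>I. E v u})"
  let ?F = "\<lambda>J. {I\<in>indep_sets E A. I \<inter> ?B = J}"
  have irr: "\<And>u. \<not> E u u" and sym: "\<And>u w. E u w \<Longrightarrow> E w u"
    using assms by (auto simp: irreflp_def symp_def)
  have key: "?c * (\<Sum>I\<in>?F J. l ^ card I) \<le> (\<Sum>I\<in>?F J. ?f I)" if J: "J \<in> indep_sets E ?B" for J
  proof -
    define H where "H = {u\<in>A. E v u \<and> (\<forall>w\<in>J. \<not> E u w)}"
    have finJ: "finite J" using indep_sets_finite[OF J] assms by simp
    have finH: "finite H" using assms by (simp add: H_def)
    have JB: "J \<subseteq> ?B" and Jind: "\<And>x y. x \<in> J \<Longrightarrow> y \<in> J \<Longrightarrow> \<not> E x y"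
      using J by (auto simp: indep_sets_def)
    have vJ: "v \<notin> J" using JB by auto
    have JH: "J \<inter> H = {}" using JB by (auto simp: H_def)
    have dec: "?F J = insert (insert v J) ((\<lambda>K. J \<union> K) ` indep_sets E H)"
    proof (intro equalityI subsetI)
      fix I assume I: "I \<in> ?F J"
      then have IA: "I \<subseteq> A" and Iind: "\<And>x y. x \<in> I \<Longrightarrow> y \<in> I \<Longrightarrow> \<not> E x y" and IB: "I \<inter> ?B = J"
        by (auto simp: indep_sets_def)
      show "I \<in> insert (insert v J) ((\<lambda>K. J \<union> K) ` indep_sets E H)"
      proof (cases "v \<in> I")
        case True
        then have "I = insert v J" using IA Iind IB by blast
        then show ?thesis by simp
      next
        case False
        have "I = J \<union> (I \<inter> H)" using False IA Iind IB by (auto simp: H_def)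
        moreover have "I \<inter> H \<in> indep_sets E H" using Iind by (auto simp: indep_sets_def)
        ultimately show ?thesis by blast
      qed
    next
      fix I assume "I \<in> insert (insert v J) ((\<lambda>K. J \<union> K) ` indep_sets E H)"
      then consider "I = insert v J" | K where "I = J \<union> K" "K \<in> indep_sets E H" by auto
      then show "I \<in> ?F J"
      proof cases
        case 1
        then show ?thesis using JB Jind irr assms(2) by (auto simp: indep_sets_def dest: sym)
      next
        case 2
        then have KH: "K \<subseteq> H" and Kind: "\<And>x y. x \<in> K \<Longrightarrow> y \<in> K \<Longrightarrow> \<not> E x y"
          by (auto simp: indep_sets_def)
        have "\<not> E x y" if "x \<in> I" "y \<in> I" for x y
          using that 2 KH Kind Jind sym by (fastforce simp: H_def)
        moreover have "I \<subseteq> A" "I \<inter> ?B = J" using 2 KH JB by (auto simp: H_def)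
        ultimately show ?thesis by (auto simp: indep_sets_def)
      qed
    qed
    have inj: "inj_on (\<lambda>K. J \<union> K) (indep_sets E H)"
      using JH by (intro inj_onI) (auto simp: indep_sets_def)
    have notin: "insert v J \<notin> (\<lambda>K. J \<union> K) ` indep_sets E H"
      using vJ irr by (auto simp: indep_sets_def H_def)
    have cardJK: "card (J \<union> K) = card J + card K" if "K \<in> indep_sets E H" for K
    proof (rule card_Un_disjoint[OF finJ indep_sets_finite[OF that finH]])
      show "J \<inter> K = {}" using that JH by (auto simp: indep_sets_def)
    qed
    have split: "(\<Sum>I\<in>?F J. g I) = g (insert v J) + (\<Sum>K\<in>indep_sets E H. g (J \<union> K))"
      for g :: "'a set \<Rightarrow> real"
      unfolding dec using notin finH by (simp add: finite_indep_sets sum.reindex[OF inj])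
    have Z_F: "(\<Sum>I\<in>?F J. l ^ card I) = l ^ card J * (l + hard_core E l H)"
      unfolding split using finJ vJ cardJK
      by (simp add: hard_core_def power_add sum_distrib_left algebra_simps)
    have f_F: "(\<Sum>I\<in>?F J. ?f I) = l ^ card J * (D * l + (\<Sum>I\<in>indep_sets E H. l ^ card I * card I))"
    proof -
      have nb: "{u\<in>insert v J. E v u} = {}" using JB irr by auto
      have "?f (J \<union> K) = l ^ card J * (l ^ card K * card K)" if K: "K \<in> indep_sets E H" for K
      proof -
        have "v \<notin> J \<union> K" "{u\<in>J \<union> K. E v u} = K"
          using K vJ irr JB by (auto simp: indep_sets_def H_def)
        then show ?thesis using cardJK[OF K] by (simp add: power_add)
      qed
      then show ?thesis
        unfolding split using finJ vJ nb by (simp add: sum_distrib_left algebra_simps)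
    qed
    \<comment> \<open>All sets in the fibre share the factor \<open>l ^ card J\<close>, so the claim
      reduces to one about \<open>H\<close>, whose adjacent pairs are among those bounded by
      hypothesis \<open>T\<close>.\<close>
    have "D * l + (\<Sum>I\<in>indep_sets E H. l ^ card I * card I) \<ge> ?c * (l + hard_core E l H)"
    proof (rule local_occupancy[OF finH assms(3-7) _ L])
      have "card {(u, w). u \<in> H \<and> w \<in> H \<and> E u w}
              \<le> card {(u, w). u \<in> A \<and> w \<in> A \<and> E v u \<and> E v w \<and> E u w}"
      proof (rule card_mono)
        show "finite {(u, w). u \<in> A \<and> w \<in> A \<and> E v u \<and> E v w \<and> E u w}"
          by (rule finite_subset[of _ "A \<times> A"]) (use assms in auto)
      qed (auto simp: H_def)
      then show "l\<^sup>2 * card {(u, w). u \<in> H \<and> w \<in> H \<and> E u w} \<le> 1"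
        using T by (smt (verit) mult_left_mono of_nat_le_iff zero_le_power2)
    qed
    then have "l ^ card J * (?c * (l + hard_core E l H))
        \<le> l ^ card J * (D * l + (\<Sum>I\<in>indep_sets E H. l ^ card I * card I))"
      using assms(5) by (intro mult_left_mono) auto
    then show ?thesis unfolding Z_F f_F by (simp only: mult.left_commute)
  qed
  have sub: "(\<lambda>I. I \<inter> ?B) ` indep_sets E A \<subseteq> indep_sets E ?B"
    by (auto simp: indep_sets_def)
  have fin: "finite (indep_sets E A)" "finite (indep_sets E ?B)"
    using assms by (auto intro: finite_indep_sets)
  have "?c * hard_core E l A = (\<Sum>J\<in>indep_sets E ?B. ?c * (\<Sum>I\<in>?F J. l ^ card I))"
    unfolding hard_core_def sum.group[OF fin sub, of "\<lambda>I. l ^ card I", symmetric]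
    by (rule sum_distrib_left)
  also have "\<dots> \<le> (\<Sum>J\<in>indep_sets E ?B. \<Sum>I\<in>?F J. ?f I)"
    by (rule sum_mono[OF key])
  also have "\<dots> = (\<Sum>I\<in>indep_sets E A. ?f I)"
    by (rule sum.group[OF fin sub])
  finally show ?thesis .
qed

text \<open>Averaging: when \<open>vertex_occupancy\<close> is summed over \<open>v\<close>, each
  \<open>I\<close> contributes \<open>D\<close> per element for being occupied and at most
  \<open>D\<close> per element for being a neighbour. If every \<open>I\<close> were small, the
  weighted total would be too small.\<close>

lemma large_indep_set_of_locally_sparse:
  fixes D l :: real
  assumes "finite A" "symp E" "irreflp E" "0 < l" "l \<le> 1/2" "D > 0"
    and deg: "\<And>v. v \<in> A \<Longrightarrow> card {u\<in>A. E v u} \<le> D"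
    and T: "\<And>v. v \<in> A \<Longrightarrow>
              l\<^sup>2 * card {(u, w). u \<in> A \<and> w \<in> A \<and> E v u \<and> E v w \<and> E u w} \<le> 1"
    and L: "4 \<le> ln (D * l)"
  shows "\<exists>I\<in>indep_sets E A. (ln (D * l) / 4 - 1) / 2 * card A \<le> 2 * D * card I"
proof (rule ccontr)
  let ?c = "(ln (D * l) / 4 - 1) / 2"
  let ?f = "\<lambda>v I. D * of_bool (v \<in> I) + card {u\<in>I. E v u}"
  assume "\<not> ?thesis"
  then have small: "2 * D * card I < ?c * card A" if "I \<in> indep_sets E A" for I
    using that by force
  have total: "(\<Sum>v\<in>A. ?f v I) \<le> 2 * D * card I" if I: "I \<in> indep_sets E A" for I
  proof -
    have IA: "I \<subseteq> A" using I by (auto simp: indep_sets_def)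
    have finI: "finite I" by (rule indep_sets_finite[OF I assms(1)])
    have "(\<Sum>v\<in>A. real (card {u\<in>I. E v u})) = (\<Sum>v\<in>A. \<Sum>u\<in>{u\<in>I. E v u}. 1)" by simp
    also have "\<dots> = (\<Sum>u\<in>I. \<Sum>v\<in>{v\<in>A. E v u}. 1)"
      by (rule sum.swap_restrict) (simp_all add: assms finI)
    also have "\<dots> \<le> (\<Sum>u\<in>I. D)"
    proof (rule sum_mono)
      fix u assume "u \<in> I"
      moreover have "{v\<in>A. E v u} = {v\<in>A. E u v}" using assms(2) by (auto simp: symp_def)
      ultimately show "(\<Sum>v\<in>{v\<in>A. E v u}. 1) \<le> D" using deg[of u] IA by auto
    qed
    finally have "(\<Sum>v\<in>A. real (card {u\<in>I. E v u})) \<le> D * card I" by (simp add: mult.commute)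
    moreover have "(\<Sum>v\<in>A. D * of_bool (v \<in> I)) = D * card I"
    proof -
      have "(\<Sum>v\<in>A. of_bool (v \<in> I) :: real) = card I"
        using IA assms(1) by (simp add: of_bool_def sum.If_cases Int_absorb1)
      then show ?thesis by (simp add: sum_distrib_left[symmetric])
    qed
    ultimately show ?thesis by (simp add: sum.distrib)
  qed
  have fin: "finite (indep_sets E A)" by (rule finite_indep_sets[OF assms(1)])
  have "card A * (?c * hard_core E l A) \<le> (\<Sum>v\<in>A. \<Sum>I\<in>indep_sets E A. l ^ card I * ?f v I)"
    using sum_mono[of A "\<lambda>_. ?c * hard_core E l A"
        "\<lambda>v. \<Sum>I\<in>indep_sets E A. l ^ card I * ?f v I"]
      vertex_occupancy[OF assms(1) _ assms(2-6) T L] by simp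
  also have "\<dots> = (\<Sum>I\<in>indep_sets E A. l ^ card I * (\<Sum>v\<in>A. ?f v I))"
    by (subst sum.swap) (simp add: sum_distrib_left)
  also have "\<dots> < (\<Sum>I\<in>indep_sets E A. l ^ card I * (?c * card A))"
  proof (rule sum_strict_mono[OF fin])
    show "indep_sets E A \<noteq> {}" using empty_indep_sets by blast
    fix I assume "I \<in> indep_sets E A"
    then show "l ^ card I * (\<Sum>v\<in>A. ?f v I) < l ^ card I * (?c * card A)"
      using total[of I] small[of I] assms(4) by (intro mult_strict_left_mono) auto
  qed
  also have "\<dots> = card A * (?c * hard_core E l A)"
    by (simp only: hard_core_def sum_distrib_right[symmetric]) (simp only: mult_ac)
  finally show False by simp
qed

section \<open>Hamming balls of permutations\<close>

text \<open>Conjugation by an enumeration of \<open>S\<close> preserves the absence of fixed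
  points.\<close>

lemma card_derangements_on:
  assumes "finite S"
  shows "card {p. p permutes S \<and> (\<forall>i\<in>S. p i \<noteq> i)} = derangements (card S)"
proof -
  let ?A = "{..<card S}"
  obtain f where f: "bij_betw f ?A S"
    using ex_bij_betw_nat_finite[OF assms] unfolding atLeast0LessThan by blast
  define g where "g = (\<lambda>p x. if x \<in> S then f (p (inv_into ?A f x)) else x)"
  have g: "bij_betw g {p. p permutes ?A} {p. p permutes S}"
    unfolding g_def by (rule bij_betw_permutations[OF f])
  have iff: "(\<forall>i\<in>S. g p i \<noteq> i) \<longleftrightarrow> (\<forall>j\<in>?A. p j \<noteq> j)" if "p permutes ?A" for p
  proof -
    have S: "f ` ?A = S" and inj: "inj_on f ?A" using f by (auto simp: bij_betw_def)
    have "g p (f j) = f j \<longleftrightarrow> p j = j" if j: "j \<in> ?A" for j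
    proof -
      have "f j \<in> S" using j S by blast
      moreover have "p j \<in> ?A" using permutes_in_image[OF \<open>p permutes ?A\<close>] j by blast
      ultimately show ?thesis
        using j inj inv_into_f_f[OF inj j] by (simp add: g_def inj_on_eq_iff)
    qed
    then have "(\<forall>i\<in>f ` ?A. g p i \<noteq> i) \<longleftrightarrow> (\<forall>j\<in>?A. p j \<noteq> j)" by blast
    then show ?thesis by (simp only: S)
  qed
  define X where "X = {p \<in> sym_perms (card S). \<forall>i<card S. p i \<noteq> i}"
  define Y where "Y = {p. p permutes S \<and> (\<forall>i\<in>S. p i \<noteq> i)}"
  have X: "p \<in> X \<longleftrightarrow> p permutes ?A \<and> (\<forall>j\<in>?A. p j \<noteq> j)" for p
    by (auto simp: X_def sym_perms_def)
  have "g ` X = Y"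
  proof (intro equalityI subsetI)
    fix q assume "q \<in> g ` X"
    then obtain p where p: "q = g p" "p \<in> X" by blast
    then have "g p permutes S" using bij_betwE[OF g] X by blast
    then show "q \<in> Y" using p X iff by (simp add: Y_def)
  next
    fix q assume q: "q \<in> Y"
    then have "q \<in> g ` {p. p permutes ?A}"
      using bij_betw_imp_surj_on[OF g] by (simp add: Y_def)
    then obtain p where "p permutes ?A" "q = g p" by blast
    then show "q \<in> g ` X" using q X iff by (simp add: Y_def)
  qed
  moreover have "inj_on g X"
    by (rule inj_on_subset[OF bij_betw_imp_inj_on[OF g]]) (use X in blast)
  ultimately have "card Y = card X" using card_image by blast
  then show ?thesis by (simp add: derangements_def X_def Y_def)
qed

text \<open>Left translation by \<open>inv v\<close> turns the positions where \<open>x\<close>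
  differs from \<open>v\<close> into the points moved by \<open>inv v \<circ> x\<close>, so counting
  around \<open>v\<close> becomes counting around the identity.\<close>

lemma sym_perms_quotient:
  assumes "v \<in> sym_perms n" "x \<in> sym_perms n" "{i\<in>{..<n}. v i \<noteq> x i} \<subseteq> W"
  shows "inv v \<circ> x permutes W" "x = v \<circ> (inv v \<circ> x)" "(inv v \<circ> x) i \<noteq> i \<longleftrightarrow> v i \<noteq> x i"
proof -
  have v: "v permutes {..<n}" and x: "x permutes {..<n}" using assms by (auto simp: sym_perms_def)
  have fp: "(inv v \<circ> x) i \<noteq> i \<longleftrightarrow> v i \<noteq> x i" for i
    using permutes_inv_eq[OF v, of "x i" i] by auto
  show "(inv v \<circ> x) i \<noteq> i \<longleftrightarrow> v i \<noteq> x i" by (rule fp)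
  show "x = v \<circ> (inv v \<circ> x)" using permutes_inverses[OF v] by (auto simp: fun_eq_iff)
  show "inv v \<circ> x permutes W"
  proof (rule permutes_superset[OF permutes_compose[OF x permutes_inv[OF v]]])
    fix i assume "i \<in> {..<n} - W"
    then show "(inv v \<circ> x) i = i" using fp[of i] assms(3) by auto
  qed
qed

lemma card_differ_within_le:
  assumes "v \<in> sym_perms n" "finite W"
  shows "card {x\<in>sym_perms n. {i\<in>{..<n}. v i \<noteq> x i} \<subseteq> W} \<le> fact (card W)"
proof -
  have "{x\<in>sym_perms n. {i\<in>{..<n}. v i \<noteq> x i} \<subseteq> W} \<subseteq> (\<lambda>p. v \<circ> p) ` {p. p permutes W}"
    using sym_perms_quotient(1,2)[OF assms(1)] by blast
  then have "card {x\<in>sym_perms n. {i\<in>{..<n}. v i \<noteq> x i} \<subseteq> W} \<le> card {p. p permutes W}"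
    using assms(2) by (intro surj_card_le) (auto simp: finite_permutations)
  then show ?thesis by (simp add: card_permutations[OF refl assms(2)])
qed

lemma card_differ_exactly_le:
  assumes "v \<in> sym_perms n" "finite W"
  shows "card {x\<in>sym_perms n. {i\<in>{..<n}. v i \<noteq> x i} = W} \<le> derangements (card W)"
proof -
  have "x \<in> (\<lambda>p. v \<circ> p) ` {p. p permutes W \<and> (\<forall>i\<in>W. p i \<noteq> i)}"
    if "x \<in> sym_perms n" "{i\<in>{..<n}. v i \<noteq> x i} = W" for x
  proof (rule image_eqI)
    show "x = v \<circ> (inv v \<circ> x)"
      using sym_perms_quotient(2)[OF assms(1) that(1)] by blast
    show "inv v \<circ> x \<in> {p. p permutes W \<and> (\<forall>i\<in>W. p i \<noteq> i)}"
      using sym_perms_quotient(1,3)[OF assms(1) that(1), of W] that(2) by auto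
  qed
  then have "{x\<in>sym_perms n. {i\<in>{..<n}. v i \<noteq> x i} = W}
      \<subseteq> (\<lambda>p. v \<circ> p) ` {p. p permutes W \<and> (\<forall>i\<in>W. p i \<noteq> i)}" by blast
  moreover have "finite {p. p permutes W \<and> (\<forall>i\<in>W. p i \<noteq> i)}"
    by (rule finite_subset[OF _ finite_permutations[OF assms(2)]]) auto
  ultimately have "card {x\<in>sym_perms n. {i\<in>{..<n}. v i \<noteq> x i} = W}
      \<le> card {p. p permutes W \<and> (\<forall>i\<in>W. p i \<noteq> i)}"
    by (intro surj_card_le)
  then show ?thesis by (simp add: card_derangements_on[OF assms(2)])
qed

text \<open>The ball is split by the exact set of positions differing from \<open>v\<close>; a set
  of size \<open>k\<close> accounts for at most \<open>derangements k\<close> permutations.\<close>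

lemma card_hamming_ball_le:
  assumes "v \<in> sym_perms n"
  shows "card {x\<in>sym_perms n. hamming n v x \<le> r} \<le> V_ball n r"
proof -
  let ?W = "\<lambda>k. {W. W \<subseteq> {..<n} \<and> card W = k}"
  let ?X = "\<lambda>W. {x\<in>sym_perms n. {i\<in>{..<n}. v i \<noteq> x i} = W}"
  have finW: "finite (?W k)" for k by (rule finite_subset[of _ "Pow {..<n}"]) auto
  have finX: "finite (?X W)" for W by (rule finite_subset[OF _ finite_sym_perms]) auto
  have "{x\<in>sym_perms n. hamming n v x \<le> r} \<subseteq> (\<Union>k\<in>{0..r}. \<Union>W\<in>?W k. ?X W)"
    by (auto simp: hamming_def)
  then have "card {x\<in>sym_perms n. hamming n v x \<le> r} \<le> card (\<Union>k\<in>{0..r}. \<Union>W\<in>?W k. ?X W)"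
    using finW finX by (intro card_mono) auto
  also have "\<dots> \<le> (\<Sum>k=0..r. card (\<Union>W\<in>?W k. ?X W))"
    by (rule card_UN_le) simp
  also have "\<dots> \<le> (\<Sum>k=0..r. (n choose k) * derangements k)"
  proof (rule sum_mono)
    fix k
    have "card (\<Union>W\<in>?W k. ?X W) \<le> (\<Sum>W\<in>?W k. card (?X W))"
      by (rule card_UN_le[OF finW])
    also have "\<dots> \<le> (\<Sum>W\<in>?W k. derangements k)"
    proof (rule sum_mono)
      fix W assume "W \<in> ?W k"
      then show "card (?X W) \<le> derangements k"
        using card_differ_exactly_le[OF assms, of W] finite_subset[of W "{..<n}"] by auto
    qed
    also have "\<dots> = (n choose k) * derangements k"
      using n_subsets[of "{..<n}" k] by simp
    finally show "card (\<Union>W\<in>?W k. ?X W) \<le> (n choose k) * derangements k" .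
  qed
  finally show ?thesis by (simp add: V_ball_def)
qed

text \<open>Every difference set in question extends to an \<open>r\<close>-subset \<open>W\<close>
  of \<open>U\<close>, and at most \<open>fact r\<close> permutations agree with \<open>v\<close>
  off \<open>W\<close>.\<close>

lemma card_ball_within_le:
  assumes "v \<in> sym_perms n" "finite U" "r \<le> card U"
  shows "card {x\<in>sym_perms n. {i\<in>{..<n}. v i \<noteq> x i} \<subseteq> U \<and> hamming n v x \<le> r}
           \<le> (card U choose r) * fact r"
proof -
  let ?W = "{W. W \<subseteq> U \<and> card W = r}"
  let ?X = "\<lambda>W. {x\<in>sym_perms n. {i\<in>{..<n}. v i \<noteq> x i} \<subseteq> W}"
  have finW: "finite ?W" by (rule finite_subset[of _ "Pow U"]) (use assms in auto)
  have finX: "finite (?X W)" for W by (rule finite_subset[OF _ finite_sym_perms]) auto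
  have "\<exists>W\<in>?W. x \<in> ?X W"
    if x: "x \<in> sym_perms n" "{i\<in>{..<n}. v i \<noteq> x i} \<subseteq> U" "hamming n v x \<le> r" for x
    using exists_subset_between[of "{i\<in>{..<n}. v i \<noteq> x i}" r U] x assms(2,3)
    by (auto simp: hamming_def)
  then have "{x\<in>sym_perms n. {i\<in>{..<n}. v i \<noteq> x i} \<subseteq> U \<and> hamming n v x \<le> r} \<subseteq> (\<Union>W\<in>?W. ?X W)"
    by blast
  then have "card {x\<in>sym_perms n. {i\<in>{..<n}. v i \<noteq> x i} \<subseteq> U \<and> hamming n v x \<le> r}
      \<le> card (\<Union>W\<in>?W. ?X W)"
    using finW finX by (intro card_mono) auto
  also have "\<dots> \<le> (\<Sum>W\<in>?W. card (?X W))" by (rule card_UN_le[OF finW])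
  also have "\<dots> \<le> (\<Sum>W\<in>?W. fact r)"
  proof (rule sum_mono)
    fix W assume W: "W \<in> ?W"
    then have "finite W" using assms(2) finite_subset by blast
    then show "card (?X W) \<le> fact r" using card_differ_within_le[OF assms(1), of W] W by simp
  qed
  also have "\<dots> = (card U choose r) * fact r" using n_subsets[OF assms(2), of r] by simp
  finally show ?thesis .
qed

text \<open>If \<open>A\<close> and \<open>B\<close> are the sets where \<open>x\<close> and \<open>y\<close> differ from \<open>v\<close>, then \<open>x\<close> and \<open>y\<close>
  differ on the symmetric difference of \<open>A\<close> and \<open>B\<close>; as all three sets have at most \<open>r\<close>
  elements, \<open>A \<union> B\<close> has at most \<open>3 r / 2\<close>.\<close>

lemma card_close_pairs_le:
  assumes v: "v \<in> sym_perms n" and m: "r \<le> m" "m \<le> n" "3 * r \<le> 2 * m + 1"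
  shows "card {(x, y). x \<in> sym_perms n \<and> y \<in> sym_perms n \<and> hamming n v x \<le> r \<and> hamming n v y \<le> r
                 \<and> hamming n x y \<le> r}
           \<le> (n choose m) * ((m choose r) * fact r)\<^sup>2"
proof -
  let ?U = "{U. U \<subseteq> {..<n} \<and> card U = m}"
  let ?X = "\<lambda>U. {x\<in>sym_perms n. {i\<in>{..<n}. v i \<noteq> x i} \<subseteq> U \<and> hamming n v x \<le> r}"
  let ?P = "{(x, y). x \<in> sym_perms n \<and> y \<in> sym_perms n \<and> hamming n v x \<le> r \<and> hamming n v y \<le> r
                 \<and> hamming n x y \<le> r}"
  have finU: "finite ?U" by (rule finite_subset[of _ "Pow {..<n}"]) auto
  have finX: "finite (?X U)" for U by (rule finite_subset[OF _ finite_sym_perms]) auto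
  have "\<exists>U\<in>?U. (x, y) \<in> ?X U \<times> ?X U" if P: "(x, y) \<in> ?P" for x y
  proof -
    define A where "A = {i\<in>{..<n}. v i \<noteq> x i}"
    define B where "B = {i\<in>{..<n}. v i \<noteq> y i}"
    have fin: "finite A" "finite B" by (auto simp: A_def B_def)
    have "card A \<le> r" "card B \<le> r" using P by (auto simp: A_def B_def hamming_def)
    moreover have "card ((A - B) \<union> (B - A)) \<le> r"
    proof -
      have "(A - B) \<union> (B - A) \<subseteq> {i\<in>{..<n}. x i \<noteq> y i}" by (auto simp: A_def B_def)
      then have "card ((A - B) \<union> (B - A)) \<le> hamming n x y"
        unfolding hamming_def by (intro card_mono) auto
      then show ?thesis using P by auto
    qed
    moreover have "card ((A - B) \<union> (B - A)) = card (A - B) + card (B - A)"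
      using fin by (intro card_Un_disjoint) auto
    moreover have "card A = card (A - B) + card (A \<inter> B)"
      using fin by (subst card_Un_disjoint[symmetric]) (auto intro: arg_cong[where f = card])
    moreover have "card B = card (B - A) + card (A \<inter> B)"
      using fin by (subst card_Un_disjoint[symmetric]) (auto intro: arg_cong[where f = card])
    moreover have "card (A \<union> B) + card (A \<inter> B) = card A + card B"
      using card_Un_Int[of A B] fin by simp
    \<comment> \<open>Twice \<open>card (A \<union> B)\<close> equals the sum of the sizes of
      \<open>A\<close>, \<open>B\<close> and their symmetric difference, hence is at most
      \<open>3 * r \<le> 2 * m + 1\<close>; parity removes the 1.\<close>
    ultimately have "card (A \<union> B) \<le> m" using m by linarith
    moreover have "A \<union> B \<subseteq> {..<n}" by (auto simp: A_def B_def)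
    \<comment> \<open>Padding to exactly \<open>m\<close> points gives one \<open>U\<close> serving
      both \<open>x\<close> and \<open>y\<close>, whence the square in the bound.\<close>
    ultimately obtain U where "A \<union> B \<subseteq> U" "U \<subseteq> {..<n}" "card U = m"
      using exists_subset_between[of "A \<union> B" m "{..<n}"] m by auto
    then show ?thesis using P by (auto simp: A_def B_def)
  qed
  then have "?P \<subseteq> (\<Union>U\<in>?U. ?X U \<times> ?X U)" by fastforce
  then have "card ?P \<le> card (\<Union>U\<in>?U. ?X U \<times> ?X U)"
    using finU finX by (intro card_mono) auto
  also have "\<dots> \<le> (\<Sum>U\<in>?U. card (?X U \<times> ?X U))" by (rule card_UN_le[OF finU])
  also have "\<dots> \<le> (\<Sum>U\<in>?U. ((m choose r) * fact r)\<^sup>2)"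
  proof (rule sum_mono)
    fix U assume U: "U \<in> ?U"
    then have "finite U" using finite_subset by blast
    then have "card (?X U) \<le> (m choose r) * fact r"
      using card_ball_within_le[OF v, of U r] U m by simp
    then show "card (?X U \<times> ?X U) \<le> ((m choose r) * fact r)\<^sup>2"
      by (simp add: card_cartesian_product power2_eq_square mult_mono)
  qed
  also have "\<dots> = (n choose m) * ((m choose r) * fact r)\<^sup>2" using n_subsets[of "{..<n}" m] by simp
  finally show ?thesis .
qed

section \<open>Estimates for the volume of balls\<close>

text \<open>Composing a derangement of \<open>k\<close> points with the transposition of
  \<open>j\<close> and \<open>k\<close> inserts the new point \<open>k\<close> into a cycle right
  after \<open>j\<close>. The results are distinct because \<open>j\<close> is recovered as the
  preimage of \<open>k\<close>.\<close>

lemma derangements_Suc_ge: "k * derangements k \<le> derangements (Suc k)"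
proof -
  let ?D = "\<lambda>k. {p \<in> sym_perms k. \<forall>i<k. p i \<noteq> i}"
  let ?f = "\<lambda>(j, p). p \<circ> Transposition.transpose j k"
  have fin: "finite (?D (Suc k))" by (rule finite_subset[OF _ finite_sym_perms]) auto
  have pk: "p k = k" "p i < k \<longleftrightarrow> i < k" if "p \<in> ?D k" for p i
    using that permutes_not_in[of p "{..<k}" k] permutes_in_image[of p "{..<k}" i]
    by (auto simp: sym_perms_def)
  have inj: "inj_on ?f ({..<k} \<times> ?D k)"
  proof (rule inj_onI, clarsimp)
    fix j p j' p'
    assume j: "j < k" "j' < k" and p: "p \<in> sym_perms k" "\<forall>i<k. p i \<noteq> i"
      and p': "p' \<in> sym_perms k" "\<forall>i<k. p' i \<noteq> i"
      and eq: "p \<circ> Transposition.transpose j k = p' \<circ> Transposition.transpose j' k"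
    have "(p' \<circ> Transposition.transpose j' k) j = k"
      unfolding eq[symmetric] using pk(1)[of p] p by simp
    moreover have "(p' \<circ> Transposition.transpose j' k) j = p' j" if "j \<noteq> j'" using that j by simp
    ultimately have jj: "j = j'" using pk(2)[of p' j] p' j by fastforce
    have "p = p \<circ> Transposition.transpose j k \<circ> Transposition.transpose j k"
      by (simp add: comp_assoc)
    also have "\<dots> = p'" unfolding eq unfolding jj by (simp add: comp_assoc)
    finally show "j = j' \<and> p = p'" using jj by simp
  qed
  have "?f ` ({..<k} \<times> ?D k) \<subseteq> ?D (Suc k)"
  proof clarsimp
    fix j p assume j: "j < k" and p: "p \<in> sym_perms k" "\<forall>i<k. p i \<noteq> i"
    have "p permutes {..<Suc k}" using p by (auto simp: sym_perms_def intro: permutes_subset)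
    then have "p \<circ> Transposition.transpose j k \<in> sym_perms (Suc k)"
      using j by (auto simp: sym_perms_def intro!: permutes_compose permutes_swap_id)
    moreover have "p (Transposition.transpose j k i) \<noteq> i" if "i < Suc k" for i
      using that j p pk[of p] by (auto simp: Transposition.transpose_def)
    ultimately show "p \<circ> Transposition.transpose j k \<in> sym_perms (Suc k) \<and>
        (\<forall>i<Suc k. p (Transposition.transpose j k i) \<noteq> i)" by blast
  qed
  from card_mono[OF fin this] show ?thesis
    by (simp add: card_image[OF inj] card_cartesian_product derangements_def)
qed

text \<open>Iterates \<open>derangements_Suc_ge\<close> from the swap of two points. The loss
  against \<open>fact r\<close> is a factor \<open>r\<close>, harmless beside factors exponential in
  \<open>r\<close>.\<close>

lemma derangements_ge_fact:
  assumes "2 \<le> r"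
  shows "fact (r - 1) \<le> derangements r"
  using assms
proof (induction r rule: dec_induct)
  case base
  have "Transposition.transpose 0 1 \<in> {p \<in> sym_perms 2. \<forall>i<2. p i \<noteq> i}"
    by (auto simp: sym_perms_def Transposition.transpose_def intro!: permutes_swap_id)
  moreover have "finite {p \<in> sym_perms 2. \<forall>i<2. p i \<noteq> i}"
    by (rule finite_subset[OF _ finite_sym_perms]) auto
  ultimately have "0 < derangements 2" unfolding derangements_def card_gt_0_iff by blast
  then show ?case by simp
next
  case (step k)
  have "fact (Suc k - 1) = k * (fact (k - 1) :: nat)"
    using step fact_reduce[of k, where 'a = nat] by simp
  also have "\<dots> \<le> k * derangements k" using step by simp
  also have "\<dots> \<le> derangements (Suc k)" by (rule derangements_Suc_ge)
  finally show ?case .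
qed

lemma derangements_le_fact: "derangements k \<le> fact k"
proof -
  have "derangements k \<le> card (sym_perms k)"
    unfolding derangements_def by (rule card_mono[OF finite_sym_perms]) auto
  then show ?thesis by (simp add: sym_perms_def card_permutations)
qed

lemma ln_2_ge_half: "1 / 2 \<le> ln (2::real)"
  using ln_le_minus_one[of "1 / 2 :: real"] by (simp add: ln_div)

lemma V_ball_pos: "0 < V_ball n r"
proof -
  have "(n choose 0) * derangements 0 \<le> V_ball n r"
    unfolding V_ball_def by (rule member_le_sum) auto
  then show ?thesis by (simp add: derangements_0)
qed

lemma V_ball_ge: "2 \<le> r \<Longrightarrow> (n choose r) * fact (r - 1) \<le> V_ball n r"
proof -
  assume r: "2 \<le> r"
  have "(n choose r) * fact (r - 1) \<le> (n choose r) * derangements r"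
    using derangements_ge_fact[OF r] by simp
  also have "\<dots> \<le> V_ball n r"
    unfolding V_ball_def by (rule member_le_sum) auto
  finally show ?thesis .
qed

text \<open>There are \<open>r + 1 \<le> n\<close> terms, each at most \<open>n ^ r\<close>. The
  crude exponent costs only a constant factor once the logarithm is taken.\<close>

lemma V_ball_le:
  assumes "1 \<le> r" "r < n"
  shows "V_ball n r \<le> n ^ (2 * r)"
proof -
  have "V_ball n r \<le> (\<Sum>i=0..r. n ^ r)"
    unfolding V_ball_def
  proof (rule sum_mono)
    fix i assume i: "i \<in> {0..r}"
    have "(n choose i) * derangements i \<le> (n choose i) * fact i"
      using derangements_le_fact by simp
    also have "\<dots> \<le> n ^ i" by (rule binomial_fact_pow)
    also have "\<dots> \<le> n ^ r" using i assms by (intro power_increasing) auto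
    finally show "(n choose i) * derangements i \<le> n ^ r" .
  qed
  also have "\<dots> = (r + 1) * n ^ r" by simp
  also have "\<dots> \<le> n * n ^ r" using assms by (intro mult_right_mono) auto
  also have "\<dots> = n ^ (r + 1)" by simp
  also have "\<dots> \<le> n ^ (2 * r)" using assms by (intro power_increasing) auto
  finally show ?thesis .
qed

text \<open>No permutation moves exactly one point; the logarithm of such a volume is therefore
  0.\<close>

lemma V_ball_le_1: "r < 2 \<Longrightarrow> V_ball n r = 1"
proof -
  assume "r < 2"
  moreover have "derangements 1 = 0"
    by (auto simp: derangements_def sym_perms_def card_eq_0_iff lessThan_Suc)
  ultimately show ?thesis
    by (cases r) (auto simp: V_ball_def derangements_0 numeral_2_eq_2)
qed

text \<open>Both sides are compared with the square of the single term
  \<open>(n choose r) * fact (r - 1)\<close> of the volume. The gain is that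
  \<open>n choose s\<close>, with \<open>s = r div 2\<close>, replaces a second
  \<open>n choose r\<close>. The losses \<open>8 ^ r\<close>, \<open>4 ^ r\<close> and
  \<open>2 ^ r\<close> multiply to \<open>64 ^ r\<close>, which is 4096 to the power
  \<open>r / 2\<close>; with the 2 in \<open>q\<close> this makes 8192.\<close>

lemma close_pairs_bound_le_V_ball:
  fixes n r :: nat
  defines "m \<equiv> 3 * r div 2"
  assumes r: "2 \<le> r" "2 * r \<le> n"
  shows "real ((n choose m) * ((m choose r) * fact r)\<^sup>2) * (real n / (8192 * real r)) powr (r / 2)
           \<le> (real (V_ball n r))\<^sup>2"
proof -
  define s where "s = r div 2"
  define F where "F = (fact (r - 1) :: nat)"
  define q where "q = n / (2 * real r)"
  have s: "s \<le> r" "m - r = s" "r \<le> m" "m \<le> n" "2 * m \<le> 3 * r" "2 * (r - s) \<ge> r" "r - s > 0"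
    using r by (auto simp: s_def m_def)
  have "(n choose m) * 1 \<le> (n choose m) * (m choose r)"
    using s by (intro mult_left_mono) (auto simp: Suc_le_eq)
  also have "\<dots> = (n choose r) * ((n - r) choose s)"
    using choose_mult[of r m n] s by simp
  also have "\<dots> \<le> (n choose r) * (n choose s)"
    by (simp add: binomial_right_mono)
  finally have b1: "(n choose m) \<le> (n choose r) * (n choose s)" by simp
  have b2: "(m choose r)\<^sup>2 \<le> 8 ^ r"
  proof -
    have "(m choose r)\<^sup>2 \<le> (2 ^ m)\<^sup>2" by (intro power_mono binomial_le_pow2) simp
    also have "\<dots> = 2 ^ (2 * m)" by (simp add: power_mult[symmetric] mult.commute)
    also have "\<dots> \<le> (2::nat) ^ (3 * r)" using s by (intro power_increasing) auto
    also have "\<dots> = 8 ^ r" by (simp add: power_mult)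
    finally show ?thesis .
  qed
  have b3: "fact r \<le> 2 ^ r * F"
  proof -
    have "fact r = r * F" using r fact_reduce[of r, where 'a = nat] by (simp add: F_def)
    then show ?thesis using less_exp[of r] by simp
  qed
  have "(fact r)\<^sup>2 \<le> (2 ^ r * F)\<^sup>2" using b3 by (intro power_mono) auto
  also have "\<dots> = 4 ^ r * F\<^sup>2"
    by (simp add: power_mult_distrib power_mult[symmetric] mult.commute[of _ 2] power_mult)
  finally have b4: "(fact r)\<^sup>2 \<le> 4 ^ r * F\<^sup>2" .
  have "(n choose m) * ((m choose r) * fact r)\<^sup>2 = (n choose m) * ((m choose r)\<^sup>2 * (fact r)\<^sup>2)"
    by (simp add: power_mult_distrib)
  also have "\<dots> \<le> ((n choose r) * (n choose s)) * (8 ^ r * (4 ^ r * F\<^sup>2))"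
    by (intro mult_mono b1 b2 b4) auto
  also have "\<dots> = (n choose r) * (n choose s) * 32 ^ r * F\<^sup>2"
    by (simp add: power_mult_distrib[symmetric] mult.assoc[symmetric])
  finally have T: "(n choose m) * ((m choose r) * fact r)\<^sup>2 \<le> (n choose r) * (n choose s) * 32 ^ r * F\<^sup>2" .
  have q1: "1 \<le> q" using r by (simp add: q_def field_simps)
  \<comment> \<open>\<open>r - s\<close> is \<open>r / 2\<close> rounded up, so the real exponent
    \<open>r / 2\<close> is safe for odd \<open>r\<close> because \<open>q\<close> is at least
    1.\<close>
  have "q powr (r / 2) \<le> q powr (real (r - s))"
    using q1 s by (intro powr_mono) auto
  also have "\<dots> = q ^ (r - s)" using q1 by (simp add: powr_realpow)
  also have "\<dots> \<le> (real (n - s) / real (r - s)) ^ (r - s)"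
  proof (rule power_mono)
    have "n / (2 * real r) = (n / 2) / real r" by simp
    also have "\<dots> \<le> real (n - s) / real (r - s)"
      using r s by (intro frac_le) (auto simp: s_def)
    finally show "q \<le> real (n - s) / real (r - s)" unfolding q_def .
  qed (use q1 in simp)
  also have "\<dots> \<le> real ((n - s) choose (r - s))"
    using r by (intro binomial_ge_n_over_k_pow_k) auto
  finally have q: "q powr (r / 2) \<le> real ((n - s) choose (r - s))" .
  \<comment> \<open>The left side is \<open>(n choose r) * (r choose s)\<close>: an
    \<open>r\<close>-set with a marked \<open>s\<close>-subset.\<close>
  have cm: "(n choose s) * ((n - s) choose (r - s)) \<le> (n choose r) * 2 ^ r"
    using choose_mult[of s r n] s r binomial_le_pow2[of r s] by (metis add_leD1 mult_2 mult_le_mono2 order_trans)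
  have q4096: "real n / (8192 * real r) = q / 4096" by (simp add: q_def)
  have "(real n / (8192 * real r)) powr (r / 2) = q powr (r / 2) / 4096 powr (r / 2)"
    unfolding q4096 using q1 by (intro powr_divide)
  also have "(4096::real) powr (r / 2) = 64 ^ r"
  proof -
    have "(4096::real) powr (r / 2) = (64 powr 2) powr (r / 2)" by simp
    also have "\<dots> = 64 powr r" by (subst powr_powr) simp
    finally show ?thesis by (simp add: powr_realpow)
  qed
  finally have "real ((n choose m) * ((m choose r) * fact r)\<^sup>2) * (real n / (8192 * real r)) powr (r / 2)
     = real ((n choose m) * ((m choose r) * fact r)\<^sup>2) * (q powr (r / 2) / 64 ^ r)" by simp
  also have "\<dots> \<le> real ((n choose r) * (n choose s) * 32 ^ r * F\<^sup>2)
                 * (real ((n - s) choose (r - s)) / 64 ^ r)"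
    by (rule mult_mono[OF of_nat_mono[OF T] divide_right_mono[OF q]]) auto
  also have "\<dots> = real ((n choose r) * 32 ^ r * F\<^sup>2) * real ((n choose s) * ((n - s) choose (r - s))) / 64 ^ r"
    by simp
  also have "\<dots> \<le> real ((n choose r) * 32 ^ r * F\<^sup>2) * real ((n choose r) * 2 ^ r) / 64 ^ r"
    using cm by (intro divide_right_mono mult_left_mono of_nat_mono) auto
  also have "\<dots> = (real ((n choose r) * F))\<^sup>2 * ((32 ^ r * 2 ^ r) / 64 ^ r)"
    by (simp add: power2_eq_square)
  also have "(32 ^ r * 2 ^ r) / 64 ^ r = (1::real)"
    by (simp add: power_mult_distrib[symmetric])
  also have "(real ((n choose r) * F))\<^sup>2 * 1 \<le> (real (V_ball n r))\<^sup>2"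
    using V_ball_ge[OF r(1), of n] unfolding F_def mult_1_right
    by (intro power_mono of_nat_mono) auto
  finally show ?thesis .
qed

section \<open>The lower bound\<close>

text \<open>One of the two factors \<open>n powr b\<close> in the last hypothesis absorbs the
  constant 8192; the other makes \<open>ln (V * l)\<close> at least \<open>b * r / 4 * ln n\<close>,
  while \<open>ln V\<close> is at most \<open>2 * r * ln n\<close>.\<close>

lemma PA_max_ge_large:
  fixes n r :: nat and b :: real
  assumes r: "2 \<le> r" and b: "0 < b" and n: "16 / b \<le> ln n"
    and rn: "real r * n powr (2 * b) \<le> n"
  shows "b / 512 * (fact n / V_ball n r) * log 2 (V_ball n r) \<le> PA_max n (r + 1)"
proof -
  define m where "m = 3 * r div 2"
  define T where "T = (n choose m) * ((m choose r) * fact r)\<^sup>2"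
  define V where "V = real (V_ball n r)"
  \<comment> \<open>The largest activity for which \<open>T\<close> close pairs still meet the
    sparsity condition.\<close>
  define l where "l = 1 / sqrt (real T)"
  define A where "A = sym_perms n"
  define E where "E = (\<lambda>x y. x \<noteq> y \<and> hamming n x y \<le> r)"
  have ln0: "0 < ln (real n)" using n b by (smt (verit) divide_pos_pos)
  have "n \<noteq> 0" using ln0 by (intro notI) simp
  moreover have "n \<noteq> 1" using ln0 by (intro notI) simp
  ultimately have n1: "1 < n" by linarith
  have nb: "8192 \<le> n powr b"
  proof -
    have "(8192::real) \<le> 2 ^ 16" by simp
    also have "\<dots> \<le> exp 1 ^ 16" using exp_ge_add_one_self[of 1] by (intro power_mono) auto
    also have "\<dots> = exp (16::real)" by (simp add: exp_of_nat_mult[symmetric])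
    also have "\<dots> \<le> exp (b * ln n)" using n b by (simp add: field_simps)
    also have "\<dots> = n powr b" using n1 by (simp add: powr_def)
    finally show ?thesis .
  qed
  have pb: "n powr (2 * b) = n powr b * n powr b" by (simp add: powr_add[symmetric])
  have "real r * (8192 * n powr b) \<le> real r * n powr (2 * b)"
    unfolding pb using nb by (intro mult_left_mono mult_right_mono) auto
  then have rb: "real r * 8192 * n powr b \<le> n" using rn by simp
  have "real r * 8192 * 8192 \<le> real r * 8192 * n powr b" using nb by (intro mult_left_mono) auto
  then have rn2: "2 * r \<le> n" using rb by linarith
  have quot: "n powr b \<le> n / (8192 * real r)" using rb r by (simp add: field_simps)
  have mn: "r \<le> m" "m \<le> n" "3 * r \<le> 2 * m + 1" using rn2 by (auto simp: m_def)
  have T4: "4 \<le> T"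
  proof -
    have "1 * 2 \<le> (m choose r) * fact r"
      using mn r fact_mono[of 2 r] by (intro mult_mono) (auto simp: Suc_le_eq fact_numeral)
    then have "2\<^sup>2 \<le> ((m choose r) * fact r)\<^sup>2" by (intro power_mono) auto
    then have "1 * 4 \<le> T" unfolding T_def using mn by (intro mult_mono) (auto simp: Suc_le_eq)
    then show ?thesis by simp
  qed
  have l: "0 < l" "l \<le> 1/2" "l\<^sup>2 = 1 / T"
  proof -
    have "sqrt 4 \<le> sqrt T" using T4 by (intro real_sqrt_le_mono) auto
    then have "2 \<le> sqrt T" by simp
    then show "l \<le> 1/2" unfolding l_def by (intro frac_le) auto
    show "0 < l" using T4 by (simp add: l_def)
    show "l\<^sup>2 = 1 / T" by (simp add: l_def power_divide)
  qed
  have V1: "1 \<le> V" using V_ball_pos[of n r] by (simp add: V_def)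
  have L: "b * r / 4 * ln n \<le> ln (V * l)"
  proof -
    have "T * n powr (b * r / 2) = T * (n powr b) powr (r / 2)" by (simp add: powr_powr)
    also have "\<dots> \<le> T * (n / (8192 * real r)) powr (r / 2)"
      using quot by (intro mult_left_mono powr_mono2) auto
    also have "\<dots> \<le> V\<^sup>2"
      unfolding T_def V_def m_def by (rule close_pairs_bound_le_V_ball[OF r rn2])
    finally have "n powr (b * r / 2) \<le> V\<^sup>2 / T" using T4 by (simp add: field_simps)
    also have "\<dots> = (V * l)\<^sup>2" using l(3) by (simp add: power_mult_distrib)
    finally have "ln (n powr (b * r / 2)) \<le> ln ((V * l)\<^sup>2)"
      using n1 V1 l by (subst ln_le_cancel_iff) auto
    moreover have "ln ((V * l)\<^sup>2) = 2 * ln (V * l)" using V1 l by (simp add: ln_realpow)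
    ultimately show ?thesis using n1 by (simp add: ln_powr)
  qed
  have "8 \<le> b * r / 4 * ln n"
  proof -
    have "16 \<le> b * ln n" using n b by (simp add: field_simps)
    then have "2 * 16 \<le> real r * (b * ln n)" using r by (intro mult_mono) auto
    then show ?thesis by (simp add: algebra_simps)
  qed
  then have L8: "8 \<le> ln (V * l)" using L by linarith
  have ham: "hamming n x y = hamming n y x" for x y
    unfolding hamming_def by (intro arg_cong[where f = card]) auto
  have "\<exists>I\<in>indep_sets E A. (ln (V * l) / 4 - 1) / 2 * card A \<le> 2 * V * card I"
  proof (rule large_indep_set_of_locally_sparse)
    show "finite A" by (simp add: A_def finite_sym_perms)
    show "symp E" "irreflp E" by (auto simp: E_def symp_def irreflp_def ham)
    show "0 < l" "l \<le> 1/2" "0 < V" "4 \<le> ln (V * l)" using l V1 L8 by auto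
  next
    fix v assume v: "v \<in> A"
    have "card {u\<in>A. E v u} \<le> card {x\<in>sym_perms n. hamming n v x \<le> r}"
      by (rule card_mono) (auto simp: A_def E_def finite_sym_perms)
    also have "\<dots> \<le> V_ball n r" using v by (intro card_hamming_ball_le) (simp add: A_def)
    finally show "card {u\<in>A. E v u} \<le> V" by (simp add: V_def)
    have "card {(u, w). u \<in> A \<and> w \<in> A \<and> E v u \<and> E v w \<and> E u w}
        \<le> card {(x, y). x \<in> sym_perms n \<and> y \<in> sym_perms n \<and> hamming n v x \<le> r \<and> hamming n v y \<le> r
                 \<and> hamming n x y \<le> r}"
    proof (rule card_mono)
      show "finite {(x, y). x \<in> sym_perms n \<and> y \<in> sym_perms n \<and> hamming n v x \<le> r
               \<and> hamming n v y \<le> r \<and> hamming n x y \<le> r}"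
        by (rule finite_subset[of _ "sym_perms n \<times> sym_perms n"]) (auto simp: finite_sym_perms)
    qed (auto simp: A_def E_def)
    also have "\<dots> \<le> T"
      unfolding T_def using v mn by (intro card_close_pairs_le) (auto simp: A_def)
    finally show "l\<^sup>2 * card {(u, w). u \<in> A \<and> w \<in> A \<and> E v u \<and> E v w \<and> E u w} \<le> 1"
      unfolding l(3) using T4 by (simp add: field_simps)
  qed
  then obtain I where I: "I \<in> indep_sets E A"
    and cI: "(ln (V * l) / 4 - 1) / 2 * card A \<le> 2 * V * card I" by blast
  \<comment> \<open>Nonadjacent distinct permutations have distance above \<open>r\<close>, so at
    least \<open>r + 1\<close>.\<close>
  have "perm_array n (r + 1) I"
    using I by (fastforce simp: perm_array_def indep_sets_def A_def E_def not_le)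
  then have IP: "card I \<le> PA_max n (r + 1)" by (rule card_le_PA_max)
  have cA: "real (card A) = fact n" by (simp add: A_def sym_perms_def card_permutations)
  have "ln V \<le> ln (real n ^ (2 * r))"
  proof -
    have "V \<le> real n ^ (2 * r)"
      unfolding V_def of_nat_power[symmetric] of_nat_le_iff
      using r rn2 by (intro V_ball_le) auto
    then show ?thesis using V1 n1 by simp
  qed
  then have lnV: "ln V \<le> 2 * r * ln n" using n1 by (simp add: ln_realpow)
  \<comment> \<open>Origin of 512: \<open>log 2 V\<close> is at most \<open>2 * ln V\<close>, hence
    at most \<open>16 / b * ln (V * l)\<close>, and a logarithm of at least 8 absorbs the
    \<open>- 1\<close> at the cost of half of \<open>ln (V * l) / 4\<close>.\<close>
  have "1 / 2 \<le> ln (2::real)" by (rule ln_2_ge_half)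
  then have "ln V / ln 2 \<le> ln V / (1 / 2)" using V1 by (intro divide_left_mono) auto
  then have "b / 512 * log 2 V \<le> b / 512 * (4 * r * ln n)"
    unfolding log_def using lnV b by (intro mult_left_mono) auto
  also have "\<dots> \<le> ln (V * l) / 32" using L by (simp add: field_simps)
  also have "\<dots> \<le> (ln (V * l) / 4 - 1) / 2 / 2" using L8 by simp
  finally have "b / 512 * log 2 V * (fact n / V) \<le> (ln (V * l) / 4 - 1) / 2 / 2 * (fact n / V)"
    using V1 by (intro mult_right_mono) auto
  also have "\<dots> \<le> card I" using cI V1 unfolding cA by (simp add: field_simps)
  finally show ?thesis using IP by (simp add: V_def mult_ac)
qed

lemma PA_max_ge_1: "1 \<le> PA_max n d"
proof -
  have "perm_array n d {id}" by (auto simp: perm_array_def sym_perms_def)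
  from card_le_PA_max[OF this] show ?thesis by simp
qed

theorem theorem3:
  fixes \<alpha> :: real
  assumes "0 < \<alpha>" and "\<alpha> < 1"
  shows "\<exists>c::real>0. \<forall>n d :: nat. n > 0 \<longrightarrow> d > 0 \<longrightarrow> real d = real n powr \<alpha> \<longrightarrow>
           real (PA_max n d) \<ge> c * (fact n / real (V_ball n (d - 1))) * log 2 (real (V_ball n (d - 1)))"
proof -
  \<comment> \<open>Chosen so that \<open>\<alpha> + 2 * b = 1\<close>, which turns
    \<open>d = n powr \<alpha>\<close> into the growth hypothesis of \<open>PA_max_ge_large\<close>.
    \<open>N\<close> bounds the remaining small \<open>n\<close>, for which the constant
    \<open>1 / fact N\<close> is meant.\<close>
  define b where "b = (1 - \<alpha>) / 2"
  define N where "N = nat \<lceil>exp (16 / b)\<rceil>"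
  define c where "c = min (b / 512) (1 / fact N)"
  have b: "0 < b" using assms by (simp add: b_def)
  have c: "0 < c" "c \<le> b / 512" "c \<le> 1 / fact N" using b by (auto simp: c_def)
  have "c * (fact n / real (V_ball n (d - 1))) * log 2 (real (V_ball n (d - 1))) \<le> real (PA_max n d)"
    if nd: "n > 0" "d > 0" "real d = real n powr \<alpha>" for n d :: nat
  proof -
    define V where "V = real (V_ball n (d - 1))"
    have V1: "1 \<le> V" using V_ball_pos[of n "d - 1"] by (simp add: V_def)
    have F0: "0 \<le> fact n / V * log 2 V" using V1 by simp
    consider "d - 1 < 2" | "2 \<le> d - 1" "16 / b \<le> ln n" | "ln n < 16 / b" by linarith
    then show ?thesis
    proof cases
      case 1
      then show ?thesis by (simp add: V_ball_le_1)
    next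
      case 2
      have "real (d - 1) * n powr (2 * b) \<le> n powr \<alpha> * n powr (2 * b)"
        using nd by (intro mult_right_mono) auto
      also have "\<dots> = n powr (\<alpha> + 2 * b)" by (rule powr_add[symmetric])
      also have "\<alpha> + 2 * b = 1" by (simp add: b_def field_simps)
      also have "n powr 1 = n" using nd by simp
      finally have "b / 512 * (fact n / V) * log 2 V \<le> PA_max n d"
        using PA_max_ge_large[OF 2(1) b 2(2)] nd by (simp add: V_def)
      moreover have "c * (fact n / V * log 2 V) \<le> b / 512 * (fact n / V * log 2 V)"
        using F0 c by (intro mult_right_mono) auto
      ultimately show ?thesis by (simp add: V_def mult.assoc)
    next
      case 3
      have "real n < exp (16 / b)" using 3 nd by (metis exp_less_cancel_iff exp_ln of_nat_0_less_iff)
      then have "n \<le> N" unfolding N_def by linarith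
      then have "(fact n :: real) \<le> fact N" by (rule fact_mono)
      \<comment> \<open>For small \<open>n\<close> the claimed bound is thus at most
        \<open>c * fact N \<le> 1\<close>, and a one-element array suffices.\<close>
      moreover have "log 2 V \<le> V"
      proof -
        have "ln V \<le> V * ln 2"
        proof -
          have "ln V = ln (V / 2) + ln 2" using V1 by (simp add: ln_div)
          also have "\<dots> \<le> V / 2"
            using ln_le_minus_one[of "V / 2"] ln_le_minus_one[of 2] V1 by simp
          also have "\<dots> \<le> V * ln 2"
            using mult_left_mono[of "1 / 2" "ln 2" V] ln_2_ge_half V1 by simp
          finally show ?thesis .
        qed
        then show ?thesis by (simp add: log_def field_simps)
      qed
      then have "log 2 V / V \<le> 1" using V1 by simp
      ultimately have "fact n * (log 2 V / V) \<le> fact N * 1" using V1 by (intro mult_mono) auto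
      then have "c * (fact n / V * log 2 V) \<le> 1 / fact N * fact N"
        using c F0 by (intro mult_mono) auto
      also have "\<dots> \<le> PA_max n d" using PA_max_ge_1[of n d] by simp
      finally show ?thesis by (simp add: V_def mult.assoc)
    qed
  qed
  then show ?thesis using c(1) by blast
qed

end
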